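(* Let $p\colon E\to B$ be a simplicial fibration where $B$ is strongly collapsible. Then, for any vertex $b_0\in B$, the simplicial fibration $p$ has the same type of fibrewise contiguity as the trivial fibration $B\times p^{-1}(b_0)\to B$ (projection onto the first factor).
   Context: Simplicial complexes are abstract simplicial complexes, not necessarily finite; simplicial maps are maps of vertex sets sending simplices to simplices. The (categorical) product $K\times L$ has vertex set $V(K)\times V(L)$, and a finite set of vertices is a simplex iff both its projections are simplices. For $m\ge1$, $I_m$ is the one-dimensional complex with vertices $0,\dots,m$ and edges $\{j,j+1\}$, $0\le j<m$. A simplicial map $p\colon E\to B$ is a simplicial fibration if for every simplicial complex $K$ (finite or not), every $m\ge1$, and all simplicial maps $H\colon K\times I_m\to B$ and $\varphi\colon K\times\{0\}\to E$ with $p(\varphi(v,0))=H(v,0)$ for all vertices $v$, there is a simplicial map $\widetilde H\colon K\times I_m\to E$ with $\widetilde H(v,0)=\varphi(v,0)$ for all $v$ and $p\circ\widetilde H=H$. The fiber $p^{-1}(b_0)$ is the full subcomplex of $E$ generated by the vertices $e$ with $p(e)=b_0$. Simplicial maps $\varphi,\psi\colon K\to L$ are contiguous, $\varphi\sim_c\psi$, if $\varphi(\sigma)\cup\psi(\sigma)$ is a simplex of $L$ for every simplex $\sigma$ of $K$; they are in the same contiguity class, $\varphi\sim\psi$, if they are joined by a finite sequence of simplicial maps with consecutive ones contiguous. Two complexes $K,L$ have the same strong homotopy type if there are simplicial maps $\varphi\colon K\to L$ and $\psi\colon L\to K$ with $\psi\circ\varphi\sim 1_K$ and $\varphi\circ\psi\sim1_L$.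 A complex is strongly collapsible if it has the same strong homotopy type as a point (the one-vertex complex). Given a simplicial fibration $q\colon X\to B$ and simplicial maps $f,g\colon K\to X$, write $f\sim_q g$ (same class of fibrewise contiguity) if there is a finite sequence of simplicial maps $f=f_0\sim_c\cdots\sim_c f_n=g$ with $q\circ f_i=q\circ f$ for all $i$. Two simplicial fibrations $p_1\colon E_1\to B$, $p_2\colon E_2\to B$ have the same type of fibrewise contiguity if there are simplicial maps $f\colon E_1\to E_2$ and $g\colon E_2\to E_1$ with $p_2\circ f=p_1$, $p_1\circ g=p_2$, $g\circ f\sim_{p_1}1_{E_1}$ and $f\circ g\sim_{p_2}1_{E_2}$. *)

theory Defs
  imports Main
begin

text \<open>A simplicial complex is given by its set of (nonempty, finite) simplices, and its vertices
  are the elements of its simplices. Vertex maps are total functions of which only the values on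
  vertices matter; identities between them are required on vertices only.\<close>

definition simplicial_complex :: "'a set set \<Rightarrow> bool" where
  "simplicial_complex K \<longleftrightarrow>
     (\<forall>s\<in>K. finite s \<and> s \<noteq> {}) \<and> (\<forall>s\<in>K. \<forall>t. t \<noteq> {} \<and> t \<subseteq> s \<longrightarrow> t \<in> K)"

definition vertices :: "'a set set \<Rightarrow> 'a set" where
  "vertices K = \<Union>K"

definition simplicial_map :: "'a set set \<Rightarrow> 'b set set \<Rightarrow> ('a \<Rightarrow> 'b) \<Rightarrow> bool" where
  "simplicial_map K L f \<longleftrightarrow> (\<forall>s\<in>K. f ` s \<in> L)"

definition sprod :: "'a set set \<Rightarrow> 'b set set \<Rightarrow> ('a \<times> 'b) set set" (infixr "\<times>\<^sub>s" 80) where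
  "K \<times>\<^sub>s L = {s. finite s \<and> fst ` s \<in> K \<and> snd ` s \<in> L}"

definition interval_complex :: "nat \<Rightarrow> nat set set" where
  "interval_complex m = {{j} |j. j \<le> m} \<union> {{j, Suc j} |j. j < m}"

definition homotopy_lifting ::
    "'k set set \<Rightarrow> 'e set set \<Rightarrow> 'b set set \<Rightarrow> ('e \<Rightarrow> 'b) \<Rightarrow> bool" where
  "homotopy_lifting K E B p \<longleftrightarrow>
     (\<forall>m\<ge>1. \<forall>H \<phi>.
        simplicial_map (K \<times>\<^sub>s interval_complex m) B H \<and>
        simplicial_map (K \<times>\<^sub>s {{0::nat}}) E \<phi> \<and>
        (\<forall>v\<in>vertices K. p (\<phi> (v, 0)) = H (v, 0)) \<longrightarrow>
        (\<exists>H'. simplicial_map (K \<times>\<^sub>s interval_complex m) E H' \<and>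
              (\<forall>v\<in>vertices K. H' (v, 0) = \<phi> (v, 0)) \<and>
              (\<forall>x\<in>vertices (K \<times>\<^sub>s interval_complex m). p (H' x) = H x)))"

text \<open>A definition cannot quantify over all types of vertices, so \<open>K\<close> ranges over the complexes with
  vertices in one type. This is no restriction: that type accommodates, for every \<open>m\<close>, the
  universal lifting problem, whose vertices are the pairs of a vertex \<open>e\<close> of \<open>E\<close> and a path of
  length \<open>m\<close> in \<open>B\<close> starting at \<open>p e\<close>. The lemma \<open>simplicial_fibration_lifting\<close> below derives the
  lifting property for complexes \<open>K\<close> over an arbitrary type.\<close>

definition simplicial_fibration :: "'e set set \<Rightarrow> 'b set set \<Rightarrow> ('e \<Rightarrow> 'b) \<Rightarrow> bool" where
  "simplicial_fibration E B p \<longleftrightarrow>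
     simplicial_complex E \<and> simplicial_complex B \<and> simplicial_map E B p \<and>
     (\<forall>K :: ('e \<times> (nat \<Rightarrow> 'b)) set set. simplicial_complex K \<longrightarrow> homotopy_lifting K E B p)"

definition fiber :: "'e set set \<Rightarrow> ('e \<Rightarrow> 'b) \<Rightarrow> 'b \<Rightarrow> 'e set set" where
  "fiber E p b = {s \<in> E. \<forall>e\<in>s. p e = b}"

definition contiguous ::
    "'a set set \<Rightarrow> 'b set set \<Rightarrow> ('a \<Rightarrow> 'b) \<Rightarrow> ('a \<Rightarrow> 'b) \<Rightarrow> bool" where
  "contiguous K L f g \<longleftrightarrow>
     simplicial_map K L f \<and> simplicial_map K L g \<and> (\<forall>s\<in>K. f ` s \<union> g ` s \<in> L)"

text \<open>In the next two definitions it is harmless to demand equality of total functions at the ends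
  of the sequence: simplicial maps that agree on the vertices are contiguous.\<close>

definition same_contiguity_class ::
    "'a set set \<Rightarrow> 'b set set \<Rightarrow> ('a \<Rightarrow> 'b) \<Rightarrow> ('a \<Rightarrow> 'b) \<Rightarrow> bool" where
  "same_contiguity_class K L f g \<longleftrightarrow>
     (\<exists>n F. (\<forall>i\<le>n. simplicial_map K L (F i)) \<and> F 0 = f \<and> F n = g \<and>
            (\<forall>i<n. contiguous K L (F i) (F (Suc i))))"

definition same_fibrewise_class ::
    "'a set set \<Rightarrow> 'x set set \<Rightarrow> ('x \<Rightarrow> 'b) \<Rightarrow> ('a \<Rightarrow> 'x) \<Rightarrow> ('a \<Rightarrow> 'x) \<Rightarrow> bool" where
  "same_fibrewise_class K X q f g \<longleftrightarrow>
     (\<exists>n F. (\<forall>i\<le>n. simplicial_map K X (F i)) \<and> F 0 = f \<and> F n = g \<and>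
            (\<forall>i<n. contiguous K X (F i) (F (Suc i))) \<and>
            (\<forall>i\<le>n. \<forall>v\<in>vertices K. q (F i v) = q (f v)))"

definition same_strong_homotopy_type :: "'a set set \<Rightarrow> 'b set set \<Rightarrow> bool" where
  "same_strong_homotopy_type K L \<longleftrightarrow>
     (\<exists>\<phi> \<psi>. simplicial_map K L \<phi> \<and> simplicial_map L K \<psi> \<and>
            same_contiguity_class K K (\<psi> \<circ> \<phi>) id \<and> same_contiguity_class L L (\<phi> \<circ> \<psi>) id)"

definition strongly_collapsible :: "'a set set \<Rightarrow> bool" where
  "strongly_collapsible K \<longleftrightarrow> same_strong_homotopy_type K {{()}}"

definition same_fibrewise_type ::
    "'e set set \<Rightarrow> ('e \<Rightarrow> 'b) \<Rightarrow> 'f set set \<Rightarrow> ('f \<Rightarrow> 'b) \<Rightarrow> 'b set set \<Rightarrow> bool" where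
  "same_fibrewise_type E1 p1 E2 p2 B \<longleftrightarrow>
     simplicial_fibration E1 B p1 \<and> simplicial_fibration E2 B p2 \<and>
     (\<exists>f g. simplicial_map E1 E2 f \<and> simplicial_map E2 E1 g \<and>
            (\<forall>v\<in>vertices E1. p2 (f v) = p1 v) \<and> (\<forall>w\<in>vertices E2. p1 (g w) = p2 w) \<and>
            same_fibrewise_class E1 E1 p1 (g \<circ> f) id \<and>
            same_fibrewise_class E2 E2 p2 (f \<circ> g) id)"

lemma simplicial_complex_face:
  "simplicial_complex K \<Longrightarrow> s \<in> K \<Longrightarrow> t \<subseteq> s \<Longrightarrow> t \<noteq> {} \<Longrightarrow> t \<in> K"
  unfolding simplicial_complex_def by (elim conjE, drule (1) bspec[where x = s], drule (1) bspec) iprover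

lemma simplicial_fibration_lifting:
  fixes K :: "'k set set" and E :: "'e set set" and B :: "'b set set"
  assumes fib: "simplicial_fibration E B p" and K: "simplicial_complex K"
  shows "homotopy_lifting K E B p"
  unfolding homotopy_lifting_def
proof (intro allI impI, elim conjE)
  fix m :: nat and H \<phi>
  assume m: "1 \<le> m" and H: "simplicial_map (K \<times>\<^sub>s interval_complex m) B H"
    and \<phi>: "simplicial_map (K \<times>\<^sub>s {{0::nat}}) E \<phi>"
    and start: "\<forall>v\<in>vertices K. p (\<phi> (v, 0)) = H (v, 0)"
  have E: "simplicial_complex E" and B: "simplicial_complex B"
    using fib by (auto simp: simplicial_fibration_def)
  define U :: "('e \<times> (nat \<Rightarrow> 'b)) set set" where
    "U = {s. finite s \<and> s \<noteq> {} \<and> fst ` s \<in> E \<and> (\<forall>x\<in>s. p (fst x) = snd x 0) \<and>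
             (\<forall>j<m. (\<Union>x\<in>s. snd x ` {j, Suc j}) \<in> B)}"
  define \<theta> where "\<theta> v = (\<phi> (v, 0), \<lambda>j. H (v, j))" for v
  have U: "simplicial_complex U"
    unfolding simplicial_complex_def
  proof (intro conjI ballI allI impI)
    fix s t assume s: "s \<in> U" and t: "t \<noteq> {} \<and> t \<subseteq> s"
    have "fst ` t \<in> E"
    proof -
      have "fst ` s \<in> E" using s by (simp add: U_def)
      moreover have "fst ` t \<subseteq> fst ` s" "fst ` t \<noteq> {}" using t by auto
      ultimately show ?thesis by (rule simplicial_complex_face[OF E])
    qed
    moreover have "(\<Union>x\<in>t. snd x ` {j, Suc j}) \<in> B" if "j < m" for j
    proof -
      have "(\<Union>x\<in>s. snd x ` {j, Suc j}) \<in> B" using s that by (simp add: U_def)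
      moreover have "(\<Union>x\<in>t. snd x ` {j, Suc j}) \<subseteq> (\<Union>x\<in>s. snd x ` {j, Suc j})"
        "(\<Union>x\<in>t. snd x ` {j, Suc j}) \<noteq> {}" using t by auto
      ultimately show ?thesis by (rule simplicial_complex_face[OF B])
    qed
    moreover have "finite t" "\<forall>x\<in>t. p (fst x) = snd x 0"
    proof -
      have "finite s" "\<forall>x\<in>s. p (fst x) = snd x 0" using s by (simp_all add: U_def)
      then show "finite t" "\<forall>x\<in>t. p (fst x) = snd x 0"
        using t finite_subset[of t s] by auto
    qed
    ultimately show "t \<in> U"
      using t by (simp add: U_def)
  qed (simp_all add: U_def)
  have edge: "\<exists>j<m. r \<subseteq> {j, Suc j}" if r: "r \<in> interval_complex m" for r
  proof -
    from r consider j where "j \<le> m" "r = {j}" | j where "j < m" "r = {j, Suc j}"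
      by (auto simp: interval_complex_def)
    then show ?thesis
    proof cases
      case 1
      show ?thesis
      proof (cases j)
        case 0
        then show ?thesis using 1 m by (intro exI[of _ 0]) simp
      next
        case (Suc i)
        then show ?thesis using 1 by (intro exI[of _ i]) simp
      qed
    next
      case 2
      then show ?thesis by blast
    qed
  qed
  have HU: "simplicial_map (U \<times>\<^sub>s interval_complex m) B (\<lambda>(x, j). snd x j)"
    unfolding simplicial_map_def
  proof
    fix s assume s: "s \<in> U \<times>\<^sub>s interval_complex m"
    then obtain j where j: "j < m" "snd ` s \<subseteq> {j, Suc j}"
      using edge[of "snd ` s"] unfolding sprod_def by blast
    have "fst ` s \<in> U" using s by (simp add: sprod_def)
    then have "(\<Union>x\<in>fst ` s. snd x ` {j, Suc j}) \<in> B" and ne: "s \<noteq> {}"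
      using j(1) by (simp_all add: U_def)
    moreover have "(\<lambda>(x, j). snd x j) ` s \<subseteq> (\<Union>x\<in>fst ` s. snd x ` {j, Suc j})"
      using j(2) by fastforce
    moreover have "(\<lambda>(x, j). snd x j) ` s \<noteq> {}" using ne by simp
    ultimately show "(\<lambda>(x, j). snd x j) ` s \<in> B"
      using simplicial_complex_face[OF B] by simp
  qed
  have \<phi>U: "simplicial_map (U \<times>\<^sub>s {{0::nat}}) E (\<lambda>(x, j). fst x)"
    unfolding simplicial_map_def
  proof
    fix s assume "s \<in> U \<times>\<^sub>s {{0::nat}}"
    moreover have "(\<lambda>(x, j). fst x) ` s = fst ` fst ` s" by force
    ultimately show "(\<lambda>(x, j). fst x) ` s \<in> E" by (simp add: sprod_def U_def)
  qed
  have lift: "homotopy_lifting U E B p" using fib U by (simp add: simplicial_fibration_def)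
  have startU: "\<forall>x\<in>vertices U. p (case (x, 0::nat) of (x, j) \<Rightarrow> fst x) =
      (case (x, 0) of (x, j) \<Rightarrow> snd x j)"
    by (auto simp: U_def vertices_def)
  obtain G where G: "simplicial_map (U \<times>\<^sub>s interval_complex m) E G"
    and G0: "\<forall>x\<in>vertices U. G (x, 0) = fst x"
    and pG: "\<forall>y\<in>vertices (U \<times>\<^sub>s interval_complex m). p (G y) = (case y of (x, j) \<Rightarrow> snd x j)"
    using lift[unfolded homotopy_lifting_def, THEN spec, THEN mp, OF m, THEN spec, THEN spec,
        THEN mp, OF conjI[OF HU conjI[OF \<phi>U startU]]]
    by auto
  have \<theta>: "\<theta> ` s \<in> U" if s: "s \<in> K" for s
  proof -
    have fin: "finite s" "s \<noteq> {}" using s K by (simp_all add: simplicial_complex_def)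
    have "s \<times> {0} \<in> K \<times>\<^sub>s {{0::nat}}" using s fin by (simp add: sprod_def)
    then have "\<phi> ` (s \<times> {0}) \<in> E" using \<phi> by (simp add: simplicial_map_def)
    moreover have "fst ` \<theta> ` s = \<phi> ` (s \<times> {0})" by (force simp: \<theta>_def)
    moreover have "(\<Union>x\<in>\<theta> ` s. snd x ` {j, Suc j}) \<in> B" if "j < m" for j
    proof -
      have "s \<times> {j, Suc j} \<in> K \<times>\<^sub>s interval_complex m"
        using s fin that by (auto simp: sprod_def interval_complex_def)
      then have "H ` (s \<times> {j, Suc j}) \<in> B" using H by (simp add: simplicial_map_def)
      moreover have "(\<Union>x\<in>\<theta> ` s. snd x ` {j, Suc j}) = H ` (s \<times> {j, Suc j})"
        by (auto simp: \<theta>_def)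
      ultimately show ?thesis by simp
    qed
    moreover have "\<forall>x\<in>\<theta> ` s. p (fst x) = snd x 0"
      using start s by (auto simp: \<theta>_def vertices_def)
    ultimately show ?thesis using fin by (simp add: U_def)
  qed
  have \<theta>I: "map_prod \<theta> id ` s \<in> U \<times>\<^sub>s interval_complex m"
    if s: "s \<in> K \<times>\<^sub>s interval_complex m" for s
  proof -
    have "fst ` map_prod \<theta> id ` s = \<theta> ` fst ` s" "snd ` map_prod \<theta> id ` s = snd ` s"
      by (force simp: image_image)+
    then show ?thesis using s \<theta> by (simp add: sprod_def)
  qed
  show "\<exists>H'. simplicial_map (K \<times>\<^sub>s interval_complex m) E H' \<and>
      (\<forall>v\<in>vertices K. H' (v, 0) = \<phi> (v, 0)) \<and>
      (\<forall>x\<in>vertices (K \<times>\<^sub>s interval_complex m). p (H' x) = H x)"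
  proof (intro exI conjI ballI)
    show "simplicial_map (K \<times>\<^sub>s interval_complex m) E (G \<circ> map_prod \<theta> id)"
      unfolding simplicial_map_def
    proof
      fix s assume "s \<in> K \<times>\<^sub>s interval_complex m"
      then have "G ` map_prod \<theta> id ` s \<in> E" using G \<theta>I by (simp add: simplicial_map_def)
      then show "(G \<circ> map_prod \<theta> id) ` s \<in> E" by (simp only: image_comp)
    qed
    show "(G \<circ> map_prod \<theta> id) (v, 0) = \<phi> (v, 0)" if v: "v \<in> vertices K" for v
    proof -
      have "\<theta> v \<in> vertices U" using v \<theta> by (auto simp: vertices_def)
      then show ?thesis using G0 by (simp add: \<theta>_def)
    qed
    show "p ((G \<circ> map_prod \<theta> id) x) = H x" if x: "x \<in> vertices (K \<times>\<^sub>s interval_complex m)" for x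
    proof -
      have "map_prod \<theta> id x \<in> vertices (U \<times>\<^sub>s interval_complex m)"
      proof -
        obtain s where "s \<in> K \<times>\<^sub>s interval_complex m" "x \<in> s" using x by (auto simp: vertices_def)
        then show ?thesis unfolding vertices_def by (intro UnionI[OF \<theta>I[of s]] imageI)
      qed
      then show ?thesis using pG by (cases x) (simp add: \<theta>_def)
    qed
  qed
qed

end

theory Submission
  imports Defs
begin

text \<open>Two lifts \<open>G\<close>, \<open>G'\<close> of the same homotopy with the same initial map have fibrewise contiguous
  final maps: let \<open>W\<close> run backwards along \<open>G\<close> and then forwards along \<open>G'\<close>. Its projection is
  \<open>p G(v, |i - m|)\<close>, which deforms to the final map through \<open>p G(v, max(|i - m|, t))\<close>; lift this
  deformation with initial map \<open>W\<close>. The two ends of \<open>W\<close> are joined along the three remaining sides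
  of the square, where the deformation is constantly the final map, so no relative lifting is needed.

  A contraction of \<open>B\<close> to \<open>b0\<close> lifts to maps \<open>E \<rightarrow> B \<times> p\<^sup>-\<^sup>1(b0)\<close> (following it) and
  \<open>B \<times> p\<^sup>-\<^sup>1(b0) \<rightarrow> E\<close> (following it backwards), and this uniqueness of lifts shows that they are
  inverse to each other up to fibrewise contiguity.\<close>

section \<open>Simplicial maps and products\<close>

lemma simplicial_mapD: "simplicial_map K L f \<Longrightarrow> s \<in> K \<Longrightarrow> f ` s \<in> L"
  by (simp add: simplicial_map_def)

lemma simplicial_map_comp:
  "simplicial_map K L f \<Longrightarrow> simplicial_map L M g \<Longrightarrow> simplicial_map K M (\<lambda>x. g (f x))"
  unfolding simplicial_map_def by (metis image_image)

lemma simplicial_map_cong: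
  "simplicial_map K L f \<Longrightarrow> (\<And>v. v \<in> vertices K \<Longrightarrow> f v = g v) \<Longrightarrow> simplicial_map K L g"
  unfolding simplicial_map_def vertices_def by (metis Union_iff image_cong)

lemma simplicial_map_vertex:
  "simplicial_map K L f \<Longrightarrow> v \<in> vertices K \<Longrightarrow> f v \<in> vertices L"
  unfolding simplicial_map_def vertices_def by blast

lemma simplicial_complex_finite: "simplicial_complex K \<Longrightarrow> s \<in> K \<Longrightarrow> finite s"
  by (simp add: simplicial_complex_def)

lemma simplicial_complex_nonempty: "simplicial_complex K \<Longrightarrow> s \<in> K \<Longrightarrow> s \<noteq> {}"
  by (simp add: simplicial_complex_def)

lemma simplicial_complex_vertex:
  "simplicial_complex K \<Longrightarrow> v \<in> vertices K \<longleftrightarrow> {v} \<in> K"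
  unfolding vertices_def using simplicial_complex_face[of K _ "{v}"] by blast

lemma simplicial_map_const:
  "simplicial_complex K \<Longrightarrow> simplicial_complex L \<Longrightarrow> c \<in> vertices L \<Longrightarrow> simplicial_map K L (\<lambda>_. c)"
  using simplicial_complex_nonempty[of K]
  by (auto simp: simplicial_map_def simplicial_complex_vertex image_constant_conv)

lemma simplicial_map_id: "simplicial_map K K (\<lambda>x. x)"
  by (simp add: simplicial_map_def)

lemma simplicial_map_fst: "simplicial_map (K \<times>\<^sub>s L) K fst"
  by (simp add: simplicial_map_def sprod_def)

lemma simplicial_map_snd: "simplicial_map (K \<times>\<^sub>s L) L snd"
  by (simp add: simplicial_map_def sprod_def)

lemma simplicial_map_Pair:
  assumes "simplicial_complex K" "simplicial_map K L f" "simplicial_map K M g"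
  shows "simplicial_map K (L \<times>\<^sub>s M) (\<lambda>x. (f x, g x))"
  using assms by (auto simp: simplicial_map_def sprod_def image_image simplicial_complex_def)

lemma simplicial_complex_sprod:
  assumes "simplicial_complex K" "simplicial_complex L"
  shows "simplicial_complex (K \<times>\<^sub>s L)"
  unfolding simplicial_complex_def
proof (intro conjI ballI allI impI)
  fix s assume s: "s \<in> K \<times>\<^sub>s L"
  then show "finite s" by (simp add: sprod_def)
  show "s \<noteq> {}" using s simplicial_complex_nonempty[OF assms(1)] by (auto simp: sprod_def)
  fix t assume t: "t \<noteq> {} \<and> t \<subseteq> s"
  then have "fst ` t \<in> K" "snd ` t \<in> L"
    using s simplicial_complex_face[OF assms(1), of "fst ` s" "fst ` t"]
      simplicial_complex_face[OF assms(2), of "snd ` s" "snd ` t"]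
    by (auto simp: sprod_def image_mono)
  then show "t \<in> K \<times>\<^sub>s L" using s t by (auto simp: sprod_def intro: finite_subset)
qed

lemma vertices_sprod:
  assumes "simplicial_complex K" "simplicial_complex L"
  shows "vertices (K \<times>\<^sub>s L) = vertices K \<times> vertices L"
  using assms simplicial_complex_sprod[OF assms]
  by (auto simp: simplicial_complex_vertex sprod_def)

text \<open>A nonempty set of naturals that pairwise differ by at most one lies in
  \<open>{j, Suc j}\<close> for its least element \<open>j\<close>. In this form only arithmetic
  remains when simplices of the interval are checked.\<close>

lemma interval_complex_iff:
  "s \<in> interval_complex m \<longleftrightarrow> s \<noteq> {} \<and> (\<forall>x\<in>s. x \<le> m) \<and> (\<forall>x\<in>s. \<forall>y\<in>s. x \<le> Suc y)"
proof
  assume s: "s \<noteq> {} \<and> (\<forall>x\<in>s. x \<le> m) \<and> (\<forall>x\<in>s. \<forall>y\<in>s. x \<le> Suc y)"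
  define j where "j = (LEAST x. x \<in> s)"
  have j: "j \<in> s" using s unfolding j_def by (metis LeastI ex_in_conv)
  have "j \<le> x" if "x \<in> s" for x using that unfolding j_def by (rule Least_le)
  moreover have "x \<le> Suc j" if "x \<in> s" for x using s j that by blast
  ultimately have "s \<subseteq> {j, Suc j}" by (auto simp: le_Suc_eq intro: le_antisym)
  then have "s = {j} \<or> s = {j, Suc j}" using j by blast
  then show "s \<in> interval_complex m" using s j by (auto simp: interval_complex_def Suc_le_eq)
qed (auto simp: interval_complex_def)

lemma simplicial_complex_interval: "simplicial_complex (interval_complex m)"
proof -
  have "finite s" if "s \<in> interval_complex m" for s
    using that by (auto simp: interval_complex_def)
  then show ?thesis
    by (auto simp: simplicial_complex_def interval_complex_iff subset_iff)
qed

lemma vertices_interval: "vertices (interval_complex m) = {..m}"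
  by (auto simp: simplicial_complex_vertex[OF simplicial_complex_interval] interval_complex_iff)

lemmas vertices_cylinder = vertices_sprod[OF _ simplicial_complex_interval, unfolded vertices_interval]

lemma simplicial_map_into_interval:
  assumes "simplicial_complex K"
    and "\<And>x. x \<in> vertices K \<Longrightarrow> h x \<le> m"
    and "\<And>s x y. s \<in> K \<Longrightarrow> x \<in> s \<Longrightarrow> y \<in> s \<Longrightarrow> h x \<le> Suc (h y)"
  shows "simplicial_map K (interval_complex m) h"
  unfolding simplicial_map_def
proof
  fix s assume s: "s \<in> K"
  then have "s \<noteq> {}" "\<forall>x\<in>s. x \<in> vertices K"
    using simplicial_complex_nonempty[OF assms(1)] by (auto simp: vertices_def)
  then show "h ` s \<in> interval_complex m"
    using assms(2) assms(3)[OF s] by (auto simp: interval_complex_iff)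
qed

section \<open>The fiber as a full subcomplex\<close>

lemma simplicial_complex_fiber: "simplicial_complex E \<Longrightarrow> simplicial_complex (fiber E p b)"
  by (auto simp: simplicial_complex_def fiber_def subset_iff)

text \<open>The fiber is full: a simplex of \<open>E\<close> whose vertices all lie over
  \<open>b\<close> is already a simplex of the fiber, so a condition on vertices suffices.\<close>

lemma simplicial_map_into_fiber:
  "simplicial_map K (fiber E p b) f \<longleftrightarrow>
     simplicial_map K E f \<and> (\<forall>v\<in>vertices K. p (f v) = b)"
  unfolding simplicial_map_def fiber_def vertices_def by blast

section \<open>Contiguity and homotopies over an interval\<close>

text \<open>One step of a fibrewise chain. Projections are compared between neighbours only, so that
  chains become the reflexive transitive closure of a relation.\<close>

definition fibrewise_contiguous ::
    "'a set set \<Rightarrow> 'x set set \<Rightarrow> ('x \<Rightarrow> 'b) \<Rightarrow> ('a \<Rightarrow> 'x) \<Rightarrow> ('a \<Rightarrow> 'x) \<Rightarrow> bool" where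
  "fibrewise_contiguous K X q f g \<longleftrightarrow> contiguous K X f g \<and> (\<forall>v\<in>vertices K. q (f v) = q (g v))"

lemma contiguous_sym: "contiguous K L f g \<Longrightarrow> contiguous K L g f"
  by (simp add: contiguous_def Un_commute)

text \<open>Vertex maps are total functions, but the constructions below control their values on
  vertices only. Differences elsewhere thus cost a single contiguity step.\<close>

lemma contiguous_vertices_eq:
  assumes "simplicial_map K L f" "\<And>v. v \<in> vertices K \<Longrightarrow> f v = g v"
  shows "contiguous K L f g"
proof -
  have "f ` s = g ` s" if "s \<in> K" for s
    using that assms(2) by (intro image_cong) (auto simp: vertices_def)
  then show ?thesis
    using assms(1) by (simp add: contiguous_def simplicial_map_def)
qed

lemma fibrewise_contiguous_vertices_eq:
  "simplicial_map K X f \<Longrightarrow> (\<And>v. v \<in> vertices K \<Longrightarrow> f v = g v) \<Longrightarrow> fibrewise_contiguous K X q f g"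
  by (simp add: fibrewise_contiguous_def contiguous_vertices_eq)

lemma fibrewise_contiguous_rtranclp_sym:
  "(fibrewise_contiguous K X q)\<^sup>*\<^sup>* f g \<Longrightarrow> (fibrewise_contiguous K X q)\<^sup>*\<^sup>* g f"
  by (rule sympD[OF symp_rtranclp])
    (auto intro!: sympI simp: fibrewise_contiguous_def contiguous_sym)

lemma contiguous_rtranclp_sym: "(contiguous K X)\<^sup>*\<^sup>* f g \<Longrightarrow> (contiguous K X)\<^sup>*\<^sup>* g f"
  by (rule sympD[OF symp_rtranclp]) (auto intro!: sympI contiguous_sym)

lemma rtranclp_map:
  assumes "R\<^sup>*\<^sup>* x y" "\<And>a b. R a b \<Longrightarrow> S (h a) (h b)"
  shows "S\<^sup>*\<^sup>* (h x) (h y)"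
  using assms(1) by induction (auto intro: rtranclp.rtrancl_into_rtrancl assms(2))

lemma rtranclp_extend: "R a b \<Longrightarrow> R\<^sup>*\<^sup>* b c \<Longrightarrow> R c d \<Longrightarrow> R\<^sup>*\<^sup>* a d"
  by (meson converse_rtranclp_into_rtranclp rtranclp.rtrancl_into_rtrancl)

text \<open>Equality of neighbouring projections propagates along the chain to equality with the
  projection of \<open>f\<close>. Simpliciality of \<open>f\<close> covers the chain of length
  zero.\<close>

lemma same_fibrewise_class_rtranclp:
  assumes "(fibrewise_contiguous K X q)\<^sup>*\<^sup>* f g" "simplicial_map K X f"
  shows "same_fibrewise_class K X q f g"
proof -
  obtain n F where F: "F 0 = f" "F n = g"
    and step: "\<And>i. i < n \<Longrightarrow> fibrewise_contiguous K X q (F i) (F (Suc i))"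
    using assms(1) by (auto simp: rtranclp_power relpowp_fun_conv)
  have "simplicial_map K X (F i) \<and> (\<forall>v\<in>vertices K. q (F i v) = q (f v))" if "i \<le> n" for i
    using that
  proof (induction i)
    case 0
    then show ?case using assms(2) F by simp
  next
    case (Suc i)
    then show ?case using step[of i] by (simp add: fibrewise_contiguous_def contiguous_def)
  qed
  then show ?thesis
    unfolding same_fibrewise_class_def using F step
    by (intro exI[of _ n] exI[of _ F]) (simp add: fibrewise_contiguous_def)
qed

lemma same_contiguity_class_rtranclp:
  "same_contiguity_class K L f g \<Longrightarrow> (contiguous K L)\<^sup>*\<^sup>* f g"
  unfolding same_contiguity_class_def rtranclp_power relpowp_fun_conv by blast

text \<open>A simplex of the cylinder lies over some \<open>{j, Suc j}\<close>, so its image is a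
  face of the union of its images under two neighbouring maps of the chain, which contiguity makes a
  simplex.\<close>

lemma rtranclp_contiguous_homotopy:
  assumes "(contiguous K L)\<^sup>*\<^sup>* f g" and f: "simplicial_map K L f"
    and K: "simplicial_complex K" and L: "simplicial_complex L"
  obtains m H where "m \<ge> 1" "simplicial_map (K \<times>\<^sub>s interval_complex m) L H"
    "\<And>v. H (v, 0) = f v" "\<And>v. H (v, m) = g v"
proof -
  obtain n F where F: "F 0 = f" "F n = g"
    and step: "\<And>i. i < n \<Longrightarrow> contiguous K L (F i) (F (Suc i))"
    using assms(1) by (auto simp: rtranclp_power relpowp_fun_conv)
  have simp_F: "simplicial_map K L (F i)" if "i \<le> n" for i
    using that f F step by (cases i) (auto simp: contiguous_def Suc_le_eq)
  \<comment> \<open>One constant step is appended, since an interval of length 0 is not allowed in the lifting property.\<close>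
  define H where "H = (\<lambda>(v, i). F (min i n) v)"
  have "simplicial_map (K \<times>\<^sub>s interval_complex (Suc n)) L H"
    unfolding simplicial_map_def
  proof
    fix s assume s: "s \<in> K \<times>\<^sub>s interval_complex (Suc n)"
    then have fs: "fst ` s \<in> K" and ss: "snd ` s \<in> interval_complex (Suc n)"
      by (auto simp: sprod_def)
    have ne: "s \<noteq> {}" using fs simplicial_complex_nonempty[OF K] by blast
    from ss obtain j where j: "snd ` s \<subseteq> {j, Suc j}"
      unfolding interval_complex_def by blast
    have *: "F (min j n) ` fst ` s \<union> F (min (Suc j) n) ` fst ` s \<in> L"
    proof (cases "j < n")
      case True
      then show ?thesis using step[OF True] fs by (simp add: contiguous_def min_def)
    next
      case False
      then show ?thesis using simp_F[of n] fs by (simp add: simplicial_map_def min_def)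
    qed
    moreover have "H ` s \<subseteq> F (min j n) ` fst ` s \<union> F (min (Suc j) n) ` fst ` s"
    proof
      fix y assume "y \<in> H ` s"
      then obtain v i where "(v, i) \<in> s" "y = F (min i n) v" by (auto simp: H_def)
      moreover from this have "i = j \<or> i = Suc j" using j by force
      ultimately show "y \<in> F (min j n) ` fst ` s \<union> F (min (Suc j) n) ` fst ` s" by force
    qed
    ultimately show "H ` s \<in> L"
      using simplicial_complex_face[OF L *] ne by blast
  qed
  then show thesis
    using F by (intro that[of "Suc n" H]) (auto simp: H_def)
qed

lemma simplicial_map_slice:
  assumes K: "simplicial_complex K" and D: "simplicial_map (K \<times>\<^sub>s interval_complex m) X D"
    and i: "i \<le> m"
  shows "simplicial_map K X (\<lambda>v. D (v, i))"
  by (rule simplicial_map_comp[OF _ D])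
    (use i in \<open>intro simplicial_map_Pair simplicial_map_const K simplicial_map_id
      simplicial_complex_interval; simp add: vertices_interval\<close>)

text \<open>The passage from a homotopy back to the chain of its slices. In the categorical product
  all of \<open>s \<times> {i, Suc i}\<close> is a simplex, so neighbouring slices are
  contiguous.\<close>

lemma vertical_homotopy_contiguous:
  assumes K: "simplicial_complex K" and D: "simplicial_map (K \<times>\<^sub>s interval_complex m) X D"
    and c: "\<And>v i. v \<in> vertices K \<Longrightarrow> i \<le> m \<Longrightarrow> q (D (v, i)) = c v"
  shows "(fibrewise_contiguous K X q)\<^sup>*\<^sup>* (\<lambda>v. D (v, 0)) (\<lambda>v. D (v, m))"
proof -
  have "(fibrewise_contiguous K X q)\<^sup>*\<^sup>* (\<lambda>v. D (v, 0)) (\<lambda>v. D (v, i))" if "i \<le> m" for i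
    using that
  proof (induction i)
    case 0
    then show ?case by simp
  next
    case (Suc i)
    have "(\<lambda>v. D (v, i)) ` s \<union> (\<lambda>v. D (v, Suc i)) ` s \<in> X" if s: "s \<in> K" for s
    proof -
      have "s \<times> {i, Suc i} \<in> K \<times>\<^sub>s interval_complex m"
        using s Suc.prems simplicial_complex_finite[OF K s] simplicial_complex_nonempty[OF K s]
        by (auto simp: sprod_def interval_complex_def)
      then have "D ` (s \<times> {i, Suc i}) \<in> X" by (rule simplicial_mapD[OF D])
      moreover have "D ` (s \<times> {i, Suc i}) = (\<lambda>v. D (v, i)) ` s \<union> (\<lambda>v. D (v, Suc i)) ` s" by auto
      ultimately show ?thesis by simp
    qed
    then have "fibrewise_contiguous K X q (\<lambda>v. D (v, i)) (\<lambda>v. D (v, Suc i))"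
      using Suc.prems simplicial_map_slice[OF K D] c
      by (simp add: fibrewise_contiguous_def contiguous_def)
    then show ?case using Suc by simp
  qed
  then show ?thesis by simp
qed

section \<open>Lifts in a simplicial fibration\<close>

text \<open>The working form of the lifting property: the initial map lives on \<open>K\<close>
  itself, and vertices of the cylinder are split into coordinates.\<close>

lemma simplicial_fibration_lift:
  fixes K :: "'k set set"
  assumes fib: "simplicial_fibration E B p" and K: "simplicial_complex K" and m: "1 \<le> m"
    and H: "simplicial_map (K \<times>\<^sub>s interval_complex m) B H" and f: "simplicial_map K E f"
    and start: "\<And>v. v \<in> vertices K \<Longrightarrow> p (f v) = H (v, 0)"
  obtains G where "simplicial_map (K \<times>\<^sub>s interval_complex m) E G"
    "\<And>v. v \<in> vertices K \<Longrightarrow> G (v, 0) = f v"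
    "\<And>v i. v \<in> vertices K \<Longrightarrow> i \<le> m \<Longrightarrow> p (G (v, i)) = H (v, i)"
proof -
  have f': "simplicial_map (K \<times>\<^sub>s {{0::nat}}) E (\<lambda>x. f (fst x))"
    by (rule simplicial_map_comp[OF simplicial_map_fst f])
  have start': "\<forall>v\<in>vertices K. p (f (fst (v, 0::nat))) = H (v, 0)"
    using start by simp
  obtain G where "simplicial_map (K \<times>\<^sub>s interval_complex m) E G"
    "\<forall>v\<in>vertices K. G (v, 0) = f v"
    "\<forall>x\<in>vertices (K \<times>\<^sub>s interval_complex m). p (G x) = H x"
    using simplicial_fibration_lifting[OF fib K, unfolded homotopy_lifting_def, rule_format,
        OF m conjI[OF H conjI[OF f' start']]]
    by auto
  then show thesis using that by (simp add: vertices_cylinder[OF K])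
qed

text \<open>Indices in a simplex differ by at most one, so no simplex crosses the midpoint
  \<open>m\<close>. Each lies in one half, where reflection or translation of the index keeps it a
  simplex and \<open>G\<close> or \<open>G'\<close> applies.\<close>

lemma simplicial_map_glue:
  assumes K: "simplicial_complex K"
    and G: "simplicial_map (K \<times>\<^sub>s interval_complex m) E G"
    and G': "simplicial_map (K \<times>\<^sub>s interval_complex m) E G'"
    and start: "\<And>v. v \<in> vertices K \<Longrightarrow> G (v, 0) = G' (v, 0)"
  shows "simplicial_map (K \<times>\<^sub>s interval_complex (2 * m)) E
    (\<lambda>(v, i). if i \<le> m then G (v, m - i) else G' (v, i - m))" (is "simplicial_map _ _ ?W")
  unfolding simplicial_map_def
proof
  fix s assume s: "s \<in> K \<times>\<^sub>s interval_complex (2 * m)"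
  then have fs: "fst ` s \<in> K" and ss: "snd ` s \<in> interval_complex (2 * m)" and fin: "finite s"
    by (auto simp: sprod_def)
  have snd_s: "i \<in> snd ` s" if "(v, i) \<in> s" for v i
    using imageI[OF that, of snd] by simp
  have vert: "v \<in> vertices K" if "(v, i) \<in> s" for v i
    using imageI[OF that, of fst] fs by (auto simp: vertices_def)
  from ss have ne: "s \<noteq> {}" and le: "\<And>v i. (v, i) \<in> s \<Longrightarrow> i \<le> 2 * m"
    and near: "\<And>v i w j. (v, i) \<in> s \<Longrightarrow> (w, j) \<in> s \<Longrightarrow> i \<le> Suc j"
    unfolding interval_complex_iff using snd_s by blast+
  have "\<forall>(v, i)\<in>s. m \<le> i" if "\<not> (\<forall>(v, i)\<in>s. i \<le> m)"
  proof -
    from that obtain w j where "(w, j) \<in> s" "m < j" by auto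
    then show ?thesis using near[of w j] by fastforce
  qed
  then consider "\<forall>(v, i)\<in>s. i \<le> m" | "\<forall>(v, i)\<in>s. m \<le> i" by blast
  then show "?W ` s \<in> E"
  proof cases
    case 1
    let ?r = "\<lambda>(v, i). (v, m - i)"
    have "fst ` ?r ` s = fst ` s" "snd ` ?r ` s = (\<lambda>i. m - i) ` snd ` s" by force+
    moreover have "(\<lambda>i. m - i) ` snd ` s \<in> interval_complex m"
    proof -
      have "m - i \<le> Suc (m - j)" if "(v, i) \<in> s" "(w, j) \<in> s" for v i w j
        using near[OF that(2,1)] by linarith
      then show ?thesis using ne by (auto simp: interval_complex_iff)
    qed
    ultimately have "G ` ?r ` s \<in> E" using fs fin by (intro simplicial_mapD[OF G]) (simp add: sprod_def)
    moreover have "G ` ?r ` s = ?W ` s"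
      unfolding image_image using 1 by (intro image_cong) auto
    ultimately show ?thesis by simp
  next
    case 2
    let ?r = "\<lambda>(v, i). (v, i - m)"
    have "fst ` ?r ` s = fst ` s" "snd ` ?r ` s = (\<lambda>i. i - m) ` snd ` s" by force+
    moreover have "(\<lambda>i. i - m) ` snd ` s \<in> interval_complex m"
    proof -
      have "i - m \<le> m" "i - m \<le> Suc (j - m)" if "(v, i) \<in> s" "(w, j) \<in> s" for v i w j
        using near[OF that] le[OF that(1)] by linarith+
      then show ?thesis using ne by (auto simp: interval_complex_iff)
    qed
    ultimately have "G' ` ?r ` s \<in> E" using fs fin by (intro simplicial_mapD[OF G']) (simp add: sprod_def)
    \<comment> \<open>At the index \<open>m\<close> the conditional picks \<open>G (v, 0)\<close>,
      which \<open>start\<close> identifies with \<open>G' (v, 0)\<close>.\<close>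
    moreover have "G' ` ?r ` s = ?W ` s"
      unfolding image_image using 2 by (intro image_cong) (auto simp: start vert)
    ultimately show ?thesis by simp
  qed
qed

lemma lifts_fibrewise_contiguous:
  assumes fib: "simplicial_fibration E B p" and K: "simplicial_complex K" and m: "1 \<le> m"
    and G: "simplicial_map (K \<times>\<^sub>s interval_complex m) E G"
    and G': "simplicial_map (K \<times>\<^sub>s interval_complex m) E G'"
    and start: "\<And>v. v \<in> vertices K \<Longrightarrow> G (v, 0) = G' (v, 0)"
    and proj: "\<And>v i. v \<in> vertices K \<Longrightarrow> i \<le> m \<Longrightarrow> p (G (v, i)) = p (G' (v, i))"
  shows "(fibrewise_contiguous K E p)\<^sup>*\<^sup>* (\<lambda>v. G (v, m)) (\<lambda>v. G' (v, m))"
proof -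
  have p: "simplicial_map E B p" using fib by (simp add: simplicial_fibration_def)
  define W where "W = (\<lambda>(v, i). if i \<le> m then G (v, m - i) else G' (v, i - m))"
  \<comment> \<open>Subtraction is truncated, so one summand vanishes and \<open>d i\<close> is the
    distance from \<open>i\<close> to \<open>m\<close>.\<close>
  define d where "d i = (m - i) + (i - m)" for i
  let ?I = "interval_complex m" and ?J = "interval_complex (2 * m)"
  have KJ: "simplicial_complex (K \<times>\<^sub>s ?J)" and KI: "simplicial_complex (K \<times>\<^sub>s ?I)"
    and KJI: "simplicial_complex ((K \<times>\<^sub>s ?J) \<times>\<^sub>s ?I)"
    by (simp_all add: K simplicial_complex_interval simplicial_complex_sprod)
  have vKJ: "vertices (K \<times>\<^sub>s ?J) = vertices K \<times> {..2 * m}" by (rule vertices_cylinder[OF K])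
  have W: "simplicial_map (K \<times>\<^sub>s ?J) E W"
    unfolding W_def by (rule simplicial_map_glue[OF K G G' start])
  \<comment> \<open>On a simplex the distance to \<open>m\<close> and the time coordinate each vary
    by at most one, hence so does their maximum.\<close>
  have h: "simplicial_map ((K \<times>\<^sub>s ?J) \<times>\<^sub>s ?I) ?I (\<lambda>x. max (d (snd (fst x))) (snd x))"
  proof (rule simplicial_map_into_interval[OF KJI])
    fix x assume "x \<in> vertices ((K \<times>\<^sub>s ?J) \<times>\<^sub>s ?I)"
    then show "max (d (snd (fst x))) (snd x) \<le> m"
      by (auto simp: vertices_cylinder[OF KJ] vKJ d_def)
  next
    fix s x y assume s: "s \<in> (K \<times>\<^sub>s ?J) \<times>\<^sub>s ?I" and x: "x \<in> s" and y: "y \<in> s"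
    from s have "snd ` fst ` s \<in> ?J" "snd ` s \<in> ?I" by (auto simp: sprod_def)
    then have "snd (fst x) \<le> Suc (snd (fst y))" "snd (fst y) \<le> Suc (snd (fst x))"
      "snd x \<le> Suc (snd y)"
      using x y by (auto simp: interval_complex_iff)
    moreover have "d i \<le> Suc (d j)" if "i \<le> Suc j" "j \<le> Suc i" for i j
      using that by (cases "i \<le> m"; cases "j \<le> m") (simp_all add: d_def)
    ultimately have "d (snd (fst x)) \<le> Suc (d (snd (fst y)))" "snd x \<le> Suc (snd y)" by blast+
    then show "max (d (snd (fst x))) (snd x) \<le> Suc (max (d (snd (fst y))) (snd y))"
      by linarith
  qed
  \<comment> \<open>On \<open>((v, i), t)\<close> with \<open>t = 0\<close> this is the projection
    of \<open>W\<close>; \<open>proj\<close> lets \<open>G\<close> stand for both halves. For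
    \<open>i = 0\<close>, \<open>i = 2 * m\<close> or \<open>t = m\<close> the maximum is
    \<open>m\<close>, so three sides of the square lie over \<open>p (G (v, m))\<close>.\<close>
  define H where "H x = p (G (fst (fst x), max (d (snd (fst x))) (snd x)))" for x
  have "simplicial_map ((K \<times>\<^sub>s ?J) \<times>\<^sub>s ?I) K (\<lambda>x. fst (fst x))"
    by (rule simplicial_map_comp[OF simplicial_map_fst simplicial_map_fst])
  from simplicial_map_comp[OF simplicial_map_comp[OF simplicial_map_Pair[OF KJI this h] G] p]
  have H: "simplicial_map ((K \<times>\<^sub>s ?J) \<times>\<^sub>s ?I) B H" unfolding H_def .
  have startW: "p (W x) = H (x, 0)" if "x \<in> vertices (K \<times>\<^sub>s ?J)" for x
    using that by (auto simp: vKJ W_def H_def d_def proj)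
  obtain L where L: "simplicial_map ((K \<times>\<^sub>s ?J) \<times>\<^sub>s ?I) E L"
    and L0: "\<And>x. x \<in> vertices (K \<times>\<^sub>s ?J) \<Longrightarrow> L (x, 0) = W x"
    and pL: "\<And>x i. x \<in> vertices (K \<times>\<^sub>s ?J) \<Longrightarrow> i \<le> m \<Longrightarrow> p (L (x, i)) = H (x, i)"
    using simplicial_fibration_lift[OF fib KJ m H W startW] by blast
  let ?R = "(fibrewise_contiguous K E p)\<^sup>*\<^sup>*"
  have side: "?R (\<lambda>v. L ((v, i), 0)) (\<lambda>v. L ((v, i), m))" if i: "i = 0 \<or> i = 2 * m" for i
  proof -
    have J: "i \<in> vertices ?J" using i by (auto simp: vertices_interval)
    have "simplicial_map (K \<times>\<^sub>s ?I) (K \<times>\<^sub>s ?J) (\<lambda>x. (fst x, i))"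
      by (rule simplicial_map_Pair[OF KI simplicial_map_fst
            simplicial_map_const[OF KI simplicial_complex_interval J]])
    from simplicial_map_comp[OF simplicial_map_Pair[OF KI this simplicial_map_snd] L]
    have D: "simplicial_map (K \<times>\<^sub>s ?I) E (\<lambda>x. L ((fst x, i), snd x))" .
    have "p (L ((fst (v, t), i), snd (v, t))) = p (G (v, m))" if "v \<in> vertices K" "t \<le> m" for v t
      using that i by (auto simp: pL vKJ H_def d_def max_def)
    from vertical_homotopy_contiguous[where q = p, OF K D this] show ?thesis by simp
  qed
  have top: "?R (\<lambda>v. L ((v, 0), m)) (\<lambda>v. L ((v, 2 * m), m))"
  proof -
    have D: "simplicial_map (K \<times>\<^sub>s ?J) E (\<lambda>x. L (x, m))"
      by (rule simplicial_map_slice[OF KJ L]) simp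
    have "p (L ((v, i), m)) = p (G (v, m))" if "v \<in> vertices K" "i \<le> 2 * m" for v i
    proof -
      have "d i \<le> m" using that by (auto simp: d_def)
      then show ?thesis using that by (simp add: pL vKJ H_def max_def)
    qed
    from vertical_homotopy_contiguous[where q = p, OF K D this] show ?thesis .
  qed
  have first: "fibrewise_contiguous K E p (\<lambda>v. G (v, m)) (\<lambda>v. L ((v, 0), 0))"
  proof (rule fibrewise_contiguous_vertices_eq)
    show "simplicial_map K E (\<lambda>v. G (v, m))" by (rule simplicial_map_slice[OF K G order_refl])
  qed (simp add: L0 vKJ W_def)
  have last: "fibrewise_contiguous K E p (\<lambda>v. L ((v, 2 * m), 0)) (\<lambda>v. G' (v, m))"
  proof (rule fibrewise_contiguous_vertices_eq)
    have "simplicial_map (K \<times>\<^sub>s ?J) E (\<lambda>x. L (x, 0))" by (rule simplicial_map_slice[OF KJ L le0])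
    from simplicial_map_slice[OF K this order_refl]
    show "simplicial_map K E (\<lambda>v. L ((v, 2 * m), 0))" .
    \<comment> \<open>As \<open>m \<ge> 1\<close>, the index \<open>2 * m\<close> lies past the
      midpoint, in the branch of \<open>G'\<close>.\<close>
    show "L ((v, 2 * m), 0) = G' (v, m)" if "v \<in> vertices K" for v
      using m that by (simp add: L0 vKJ W_def)
  qed
  \<comment> \<open>Up the side \<open>i = 0\<close>, along the top, and down the side
    \<open>i = 2 * m\<close>.\<close>
  have mid: "?R (\<lambda>v. L ((v, 0), 0)) (\<lambda>v. L ((v, 2 * m), 0))"
    using rtranclp_trans[OF rtranclp_trans[OF side[of 0] top]
        fibrewise_contiguous_rtranclp_sym[OF side[of "2 * m"]]] by simp
  show ?thesis
    by (rule rtranclp_extend[where R = "fibrewise_contiguous K E p", OF first mid last])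
qed

section \<open>Cylinders, the trivial fibration and the contraction of the base\<close>

lemma simplicial_map_cylinder:
  assumes "simplicial_complex K" "simplicial_map K L u"
  shows "simplicial_map (K \<times>\<^sub>s interval_complex m) (L \<times>\<^sub>s interval_complex m) (\<lambda>x. (u (fst x), snd x))"
proof (rule simplicial_map_Pair)
  show "simplicial_complex (K \<times>\<^sub>s interval_complex m)"
    by (simp add: assms(1) simplicial_complex_interval simplicial_complex_sprod)
  show "simplicial_map (K \<times>\<^sub>s interval_complex m) L (\<lambda>x. u (fst x))"
    by (rule simplicial_map_comp[OF simplicial_map_fst assms(2)])
qed (rule simplicial_map_snd)

lemma simplicial_map_reverse:
  assumes K: "simplicial_complex K" and D: "simplicial_map (K \<times>\<^sub>s interval_complex m) X D"
  shows "simplicial_map (K \<times>\<^sub>s interval_complex m) X (\<lambda>x. D (fst x, m - snd x))"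
proof -
  have KI: "simplicial_complex (K \<times>\<^sub>s interval_complex m)"
    by (simp add: K simplicial_complex_interval simplicial_complex_sprod)
  have "simplicial_map (interval_complex m) (interval_complex m) (\<lambda>i. m - i)"
    (is "simplicial_map _ _ ?r")
  proof (rule simplicial_map_into_interval[OF simplicial_complex_interval])
    fix s x y assume "s \<in> interval_complex m" "x \<in> s" "y \<in> s"
    then have "y \<le> Suc x" by (simp add: interval_complex_iff)
    then show "m - x \<le> Suc (m - y)" by linarith
  qed simp
  from simplicial_map_comp[OF simplicial_map_snd this]
  have "simplicial_map (K \<times>\<^sub>s interval_complex m) (interval_complex m) (\<lambda>x. ?r (snd x))" .
  from simplicial_map_comp[OF simplicial_map_Pair[OF KI simplicial_map_fst this] D]
  show ?thesis .
qed

text \<open>A lift lets the first coordinate follow \<open>H\<close> and keeps the second at its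
  initial value.\<close>

lemma simplicial_fibration_fst:
  fixes B :: "'b set set" and F :: "'f set set"
  assumes B: "simplicial_complex B" and F: "simplicial_complex F"
  shows "simplicial_fibration (B \<times>\<^sub>s F) B fst"
  unfolding simplicial_fibration_def
proof (intro conjI allI impI)
  show "simplicial_complex (B \<times>\<^sub>s F)" by (rule simplicial_complex_sprod[OF B F])
  show "simplicial_complex B" by (rule B)
  show "simplicial_map (B \<times>\<^sub>s F) B fst" by (rule simplicial_map_fst)
  fix K :: "(('b \<times> 'f) \<times> (nat \<Rightarrow> 'b)) set set"
  assume K: "simplicial_complex K"
  show "homotopy_lifting K (B \<times>\<^sub>s F) B fst"
    unfolding homotopy_lifting_def
  proof (intro allI impI, elim conjE)
    fix m :: nat and H \<phi>
    let ?KI = "K \<times>\<^sub>s interval_complex m"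
    assume H: "simplicial_map ?KI B H"
      and \<phi>: "simplicial_map (K \<times>\<^sub>s {{0::nat}}) (B \<times>\<^sub>s F) \<phi>"
      and start: "\<forall>v\<in>vertices K. fst (\<phi> (v, 0)) = H (v, 0)"
    have KI: "simplicial_complex ?KI"
      by (simp add: K simplicial_complex_interval simplicial_complex_sprod)
    have pt: "simplicial_complex {{0::nat}}" by (auto simp: simplicial_complex_def)
    have "simplicial_map ?KI (K \<times>\<^sub>s {{0::nat}}) (\<lambda>x. (fst x, 0))"
      by (intro simplicial_map_Pair KI simplicial_map_fst simplicial_map_const pt)
        (simp add: vertices_def)
    then have "simplicial_map ?KI F (\<lambda>x. snd (\<phi> (fst x, 0)))"
      by (rule simplicial_map_comp[OF simplicial_map_comp[OF _ \<phi>] simplicial_map_snd])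
    then have "simplicial_map ?KI (B \<times>\<^sub>s F) (\<lambda>x. (H x, snd (\<phi> (fst x, 0))))"
      by (rule simplicial_map_Pair[OF KI H])
    then show "\<exists>H'. simplicial_map ?KI (B \<times>\<^sub>s F) H' \<and>
        (\<forall>v\<in>vertices K. H' (v, 0) = \<phi> (v, 0)) \<and> (\<forall>x\<in>vertices ?KI. fst (H' x) = H x)"
      using start by (intro exI[of _ "\<lambda>x. (H x, snd (\<phi> (fst x, 0)))"]) (auto simp: prod_eq_iff)
  qed
qed

text \<open>Strong collapsibility contracts \<open>B\<close> to \<open>\<psi> ()\<close>, which may
  differ from \<open>b0\<close>. Evaluating the same chain at \<open>b0\<close> joins the constant
  map at \<open>\<psi> ()\<close> to the one at \<open>b0\<close>.\<close>

lemma strongly_collapsible_contraction: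
  assumes B: "simplicial_complex B" and "strongly_collapsible B" and b0: "b0 \<in> vertices B"
  obtains m C where "m \<ge> 1" "simplicial_map (B \<times>\<^sub>s interval_complex m) B C"
    "\<And>b. C (b, 0) = b" "\<And>b. C (b, m) = b0"
proof -
  obtain \<phi> :: "'a \<Rightarrow> unit" and \<psi> where "same_contiguity_class B B (\<psi> \<circ> \<phi>) id"
    using assms(2) unfolding strongly_collapsible_def same_strong_homotopy_type_def by blast
  moreover have "\<psi> \<circ> \<phi> = (\<lambda>_. \<psi> ())" by auto
  ultimately have R: "(contiguous B B)\<^sup>*\<^sup>* (\<lambda>_. \<psi> ()) id"
    using same_contiguity_class_rtranclp by metis
  \<comment> \<open>Contiguity on the simplex \<open>{b0}\<close> makes \<open>f b0\<close> and
    \<open>g b0\<close> span a simplex, which is all that constant maps require.\<close>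
  have "contiguous B B (\<lambda>_. f b0) (\<lambda>_. g b0)" if "contiguous B B f g" for f g
  proof -
    have "f ` {b0} \<union> g ` {b0} \<in> B"
      using that b0 simplicial_complex_vertex[OF B] unfolding contiguous_def by blast
    then have "{f b0, g b0} \<in> B" "{g b0, f b0} \<in> B" by (simp_all add: insert_commute)
    moreover have "f b0 \<in> vertices B" "g b0 \<in> vertices B"
      using that b0 by (auto simp: contiguous_def intro: simplicial_map_vertex)
    ultimately show ?thesis
      using simplicial_complex_nonempty[OF B] simplicial_map_const[OF B B]
      by (auto simp: contiguous_def image_constant_conv)
  qed
  then have "(contiguous B B)\<^sup>*\<^sup>* (\<lambda>_. \<psi> ()) (\<lambda>_. id b0)"
    by (rule rtranclp_map[of "contiguous B B" "\<lambda>_. \<psi> ()" id "contiguous B B" "\<lambda>f _. f b0", OF R])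
  then have "(contiguous B B)\<^sup>*\<^sup>* (\<lambda>_. \<psi> ()) (\<lambda>_. b0)" by simp
  with contiguous_rtranclp_sym[OF R] have *: "(contiguous B B)\<^sup>*\<^sup>* id (\<lambda>_. b0)"
    by (rule rtranclp_trans)
  have "simplicial_map B B id" using simplicial_map_id[of B] by (simp add: id_def)
  from rtranclp_contiguous_homotopy[OF * this B B] that show thesis by (metis id_apply)
qed

section \<open>The maps between \<open>E\<close> and the product, and their composites\<close>

theorem corollary7p6:
  fixes E :: "'e set set" and B :: "'b set set" and p :: "'e \<Rightarrow> 'b" and b0 :: 'b
  assumes "simplicial_fibration E B p"
    and "strongly_collapsible B"
    and "b0 \<in> vertices B"
  shows "same_fibrewise_type E p (B \<times>\<^sub>s fiber E p b0) fst B"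
proof -
  have E: "simplicial_complex E" and B: "simplicial_complex B" and p: "simplicial_map E B p"
    using assms(1) by (auto simp: simplicial_fibration_def)
  define F where "F = fiber E p b0"
  have F: "simplicial_complex F" unfolding F_def by (rule simplicial_complex_fiber[OF E])
  have BF: "simplicial_complex (B \<times>\<^sub>s F)" by (rule simplicial_complex_sprod[OF B F])
  have FE: "simplicial_map F E (\<lambda>x. x)" and pF: "\<And>x. x \<in> vertices F \<Longrightarrow> p x = b0"
    by (auto simp: F_def fiber_def simplicial_map_def vertices_def)
  have vBF: "vertices (B \<times>\<^sub>s F) = vertices B \<times> vertices F" by (rule vertices_sprod[OF B F])
  obtain m C where m: "m \<ge> 1" and C: "simplicial_map (B \<times>\<^sub>s interval_complex m) B C"
    and C0: "\<And>b. C (b, 0) = b" and Cm: "\<And>b. C (b, m) = b0"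
    using strongly_collapsible_contraction[OF B assms(2,3)] by blast
  let ?I = "interval_complex m"
  \<comment> \<open>\<open>H\<close> starts at the identity and moves \<open>e\<close> over the
    track of \<open>p e\<close> under the contraction; since \<open>C (b, m) = b0\<close>, its final
    map lands in the fiber.\<close>
  obtain H where H: "simplicial_map (E \<times>\<^sub>s ?I) E H" and H0: "\<And>e. e \<in> vertices E \<Longrightarrow> H (e, 0) = e"
    and pH: "\<And>e i. e \<in> vertices E \<Longrightarrow> i \<le> m \<Longrightarrow> p (H (e, i)) = C (p e, i)"
  proof (rule simplicial_fibration_lift[OF assms(1) E m
        simplicial_map_comp[OF simplicial_map_cylinder[OF E p] C] simplicial_map_id])
    show "p v = C (p (fst (v, 0)), snd (v, 0))" for v by (simp add: C0)
  qed simp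
  \<comment> \<open>\<open>G\<close> carries the fiber vertex \<open>snd w\<close> along the
    reversed contraction from \<open>b0\<close> to \<open>fst w\<close>, so its final map is a map
    over \<open>B\<close>.\<close>
  obtain G where G: "simplicial_map ((B \<times>\<^sub>s F) \<times>\<^sub>s ?I) E G"
    and G0: "\<And>w. w \<in> vertices (B \<times>\<^sub>s F) \<Longrightarrow> G (w, 0) = snd w"
    and pG: "\<And>w i. w \<in> vertices (B \<times>\<^sub>s F) \<Longrightarrow> i \<le> m \<Longrightarrow> p (G (w, i)) = C (fst w, m - i)"
  proof (rule simplicial_fibration_lift[OF assms(1) BF m simplicial_map_comp[OF
          simplicial_map_cylinder[OF BF simplicial_map_fst] simplicial_map_reverse[OF B C]]
        simplicial_map_comp[OF simplicial_map_snd FE]])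
    show "p (snd w) = C (fst (fst (fst (w, 0)), snd (w, 0)), m - snd (fst (fst (w, 0)), snd (w, 0)))"
      if "w \<in> vertices (B \<times>\<^sub>s F)" for w using that by (auto simp: Cm vBF pF)
  qed simp
  define f where "f e = (p e, H (e, m))" for e
  define g where "g w = G (w, m)" for w
  have HmE: "simplicial_map E E (\<lambda>e. H (e, m))" by (rule simplicial_map_slice[OF E H]) simp
  then have Hm: "simplicial_map E F (\<lambda>e. H (e, m))"
    unfolding F_def simplicial_map_into_fiber by (simp add: pH Cm)
  have f: "simplicial_map E (B \<times>\<^sub>s F) f"
    unfolding f_def by (rule simplicial_map_Pair[OF E p Hm])
  have g: "simplicial_map (B \<times>\<^sub>s F) E g"
    unfolding g_def by (rule simplicial_map_slice[OF BF G]) simp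
  have pg: "p (g w) = fst w" if "w \<in> vertices (B \<times>\<^sub>s F)" for w
    using that by (simp add: g_def pG C0)
  have vf: "f e \<in> vertices (B \<times>\<^sub>s F)" if "e \<in> vertices E" for e
    using that by (rule simplicial_map_vertex[OF f])
  have vg: "g w \<in> vertices E" if "w \<in> vertices (B \<times>\<^sub>s F)" for w
    using that by (rule simplicial_map_vertex[OF g])

  \<comment> \<open>\<open>G\<close> on \<open>f e\<close> and \<open>H\<close> run backwards both
    begin at \<open>H (e, m)\<close> and lie over \<open>C (p e, m - i)\<close>. Their ends are
    \<open>g (f e)\<close> and \<open>H (e, 0)\<close>. The pairs under \<open>fst\<close> and
    \<open>snd\<close> match the shape of the instantiated rule.\<close>
  have "(fibrewise_contiguous E E p)\<^sup>*\<^sup>* (\<lambda>e. G (f (fst (e, m)), snd (e, m))) (\<lambda>e. H (fst (e, m), m - snd (e, m)))"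
    by (rule lifts_fibrewise_contiguous[OF assms(1) E m simplicial_map_comp[OF simplicial_map_cylinder[OF E f] G]
          simplicial_map_reverse[OF E H]])
      (simp_all add: G0 pG pH vf, simp_all add: f_def)
  then have "(fibrewise_contiguous E E p)\<^sup>*\<^sup>* (g \<circ> f) (\<lambda>e. H (e, 0))"
    by (simp add: g_def comp_def)
  moreover have "(fibrewise_contiguous E E p)\<^sup>*\<^sup>* (\<lambda>e. H (e, 0)) id"
    by (rule r_into_rtranclp[of "fibrewise_contiguous E E p"],
        rule fibrewise_contiguous_vertices_eq[OF simplicial_map_slice[OF E H]]) (simp_all add: H0)
  ultimately have "(fibrewise_contiguous E E p)\<^sup>*\<^sup>* (g \<circ> f) id"
    by (rule rtranclp_trans)
  then have gf: "same_fibrewise_class E E p (g \<circ> f) id"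
    by (rule same_fibrewise_class_rtranclp) (simp add: comp_def simplicial_map_comp[OF f g])

  let ?P = "B \<times>\<^sub>s F"
  \<comment> \<open>Here both lifts begin at \<open>g w\<close> and lie over
    \<open>C (fst w, i)\<close>. Their ends are \<open>H (g w, m)\<close> and
    \<open>G (w, 0)\<close>, the latter being \<open>snd w\<close> on vertices.\<close>
  have "(fibrewise_contiguous ?P E p)\<^sup>*\<^sup>* (\<lambda>w. H (g (fst (w, m)), snd (w, m))) (\<lambda>w. G (fst (w, m), m - snd (w, m)))"
    by (rule lifts_fibrewise_contiguous[OF assms(1) BF m simplicial_map_comp[OF simplicial_map_cylinder[OF BF g] H]
          simplicial_map_reverse[OF BF G]])
      (simp_all add: H0 pG pH vg pg, simp_all add: g_def)
  then have "(fibrewise_contiguous ?P E p)\<^sup>*\<^sup>* (\<lambda>w. H (g w, m)) (\<lambda>w. G (w, 0))" by simp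
  then obtain n A where A: "A 0 = (\<lambda>w. H (g w, m))" "A n = (\<lambda>w. G (w, 0))"
    and step: "\<And>i. i < n \<Longrightarrow> fibrewise_contiguous ?P E p (A i) (A (Suc i))"
    by (auto simp: rtranclp_power relpowp_fun_conv)
  \<comment> \<open>The first map of the chain lands in the fiber and every step preserves the
    projection, so the whole chain stays in the fiber.\<close>
  have A_F: "simplicial_map ?P F (A i)" if "i \<le> n" for i
    using that
  proof (induction i)
    case 0
    show ?case unfolding A by (rule simplicial_map_comp[OF g Hm])
  next
    case (Suc i)
    then show ?case using step[of i]
      by (simp add: F_def simplicial_map_into_fiber fibrewise_contiguous_def contiguous_def)
  qed
  \<comment> \<open>Fullness again: the union is a simplex of \<open>E\<close> with all vertices
    over \<open>b0\<close>.\<close>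
  have "contiguous ?P F (A i) (A (Suc i))" if "i < n" for i
  proof -
    have 1: "A i ` s \<in> F" "A (Suc i) ` s \<in> F" if "s \<in> ?P" for s
      using that A_F[of i] A_F[of "Suc i"] \<open>i < n\<close> by (auto simp: simplicial_map_def)
    have "A i ` s \<union> A (Suc i) ` s \<in> F" if "s \<in> ?P" for s
      using 1[OF that] step[OF \<open>i < n\<close>] that
      by (auto simp: F_def fiber_def fibrewise_contiguous_def contiguous_def)
    then show ?thesis using A_F[of i] A_F[of "Suc i"] \<open>i < n\<close> by (simp add: contiguous_def)
  qed
  then have "(contiguous ?P F)\<^sup>*\<^sup>* (\<lambda>w. H (g w, m)) (\<lambda>w. G (w, 0))"
    unfolding rtranclp_power relpowp_fun_conv using A by blast
  \<comment> \<open>Pairing with the fixed first coordinate turns a chain in the fiber into a chain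
    of maps over \<open>B\<close>.\<close>
  moreover have "fibrewise_contiguous ?P ?P fst (\<lambda>w. (fst w, a w)) (\<lambda>w. (fst w, b w))"
    if "contiguous ?P F a b" for a b
  proof -
    have a: "simplicial_map ?P F a" and b: "simplicial_map ?P F b"
      and ab: "\<And>s. s \<in> ?P \<Longrightarrow> a ` s \<union> b ` s \<in> F"
      using that by (auto simp: contiguous_def)
    have "(\<lambda>w. (fst w, a w)) ` s \<union> (\<lambda>w. (fst w, b w)) ` s \<in> ?P" if s: "s \<in> ?P" for s
      using ab[OF s] s by (simp add: sprod_def image_Un image_image)
    then show ?thesis
      using simplicial_map_Pair[OF BF simplicial_map_fst a] simplicial_map_Pair[OF BF simplicial_map_fst b]
      by (simp add: fibrewise_contiguous_def contiguous_def)
  qed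
  ultimately have mid: "(fibrewise_contiguous ?P ?P fst)\<^sup>*\<^sup>* (\<lambda>w. (fst w, H (g w, m))) (\<lambda>w. (fst w, G (w, 0)))"
    by (rule rtranclp_map[of "contiguous ?P F" _ _ "fibrewise_contiguous ?P ?P fst"
          "\<lambda>a w. (fst w, a w)"])
  have fg_map: "simplicial_map ?P ?P (f \<circ> g)"
    using simplicial_map_comp[OF g f] by (simp add: comp_def)
  \<comment> \<open>The first coordinate of \<open>f (g w)\<close> is \<open>p (g w)\<close>, known
    to equal \<open>fst w\<close> on vertices only; \<open>last\<close> absorbs
    \<open>G (w, 0) = snd w\<close> in the same way.\<close>
  have first: "fibrewise_contiguous ?P ?P fst (f \<circ> g) (\<lambda>w. (fst w, H (g w, m)))"
    by (rule fibrewise_contiguous_vertices_eq[OF fg_map]) (simp add: f_def pg)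
  have last: "fibrewise_contiguous ?P ?P fst (\<lambda>w. (fst w, G (w, 0))) id"
  proof (rule fibrewise_contiguous_vertices_eq)
    have id: "simplicial_map ?P ?P id" using simplicial_map_id by (simp add: id_def)
    show "simplicial_map ?P ?P (\<lambda>w. (fst w, G (w, 0)))"
      by (rule simplicial_map_cong[OF id]) (simp add: G0)
  qed (simp add: G0)
  have "(fibrewise_contiguous ?P ?P fst)\<^sup>*\<^sup>* (f \<circ> g) id"
    by (rule rtranclp_extend[where R = "fibrewise_contiguous ?P ?P fst", OF first mid last])
  then have fg: "same_fibrewise_class ?P ?P fst (f \<circ> g) id"
    by (rule same_fibrewise_class_rtranclp) (rule fg_map)

  have "same_fibrewise_type E p ?P fst B"
    unfolding same_fibrewise_type_def
    using assms(1) simplicial_fibration_fst[OF B F] f g gf fg pg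
    by (intro conjI exI[of _ f] exI[of _ g]) (auto simp: f_def)
  then show ?thesis by (simp add: F_def)
qed

end
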